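(* Let $g_n := n^{3/2}$ for $n\in\mathbb{N}_0$, and define, for $n\ge 2$, \[ \rho^{(2)}_n := \frac{g_{n-2}-4g_{n-1}+6g_n-4g_{n+1}+g_{n+2}}{g_n} =6-4\Big(1+\tfrac1n\Big)^{3/2}-4\Big(1-\tfrac1n\Big)^{3/2}+\Big(1+\tfrac2n\Big)^{3/2}+\Big(1-\tfrac2n\Big)^{3/2}. \] Then: (i) For all $u\in H_0^2(\mathbb{N}_0)$, \[ \sum_{n=1}^{\infty}\left|(-\Delta u)_n\right|^2\ \ge\ \sum_{n=2}^{\infty}\rho^{(2)}_n|u_n|^2 . \] (ii) (Non-attainability) If $u=\{u_n\}_{n\in\mathbb{N}_0}$ is a complex sequence with $u_0=u_1=0$ such that $\sum_{n=2}^\infty \rho^{(2)}_n|u_n|^2<\infty$ and $\sum_{n=1}^{\infty}|(-\Delta u)_n|^2=\sum_{n=2}^{\infty}\rho^{(2)}_n|u_n|^2$, then $u=0$. (iii) (Optimality near infinity) For every integer $M\ge 2$, \[ \inf_{u\in H_0^M(\mathbb{N}_0)\setminus\{0\}}\frac{\sum_{n=1}^{\infty}|(-\Delta u)_n|^2}{\sum_{n=2}^{\infty}\rho^{(2)}_n|u_n|^2}=1; \] equivalently, for every $M\ge2$ and $\varepsilon>0$ there is a finitely supported nonzero $u\in H_0^M(\mathbb{N}_0)$ with $\sum_{n\ge1}|(-\Delta u)_n|^2<(1+\varepsilon)\sum_{n\ge2}\rho^{(2)}_n|u_n|^2$.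
   Context: For $M\in\mathbb{N}$, $H_0^M(\mathbb{N}_0):=\{u\in\ell^2(\mathbb{N}_0): u_0=\dots=u_{M-1}=0\}$. The discrete Dirichlet Laplacian acts on complex sequences indexed by $\mathbb{N}_0$ by $(-\Delta u)_0=2u_0-u_1$ and $(-\Delta u)_n=-u_{n-1}+2u_n-u_{n+1}$ for $n\in\mathbb{N}$. Note $\rho^{(2)}=((-\Delta)^2 g)/g$ on $n\ge2$. *)

theory Defs
  imports Complex_Main
begin

definition g :: "nat \<Rightarrow> real" where
  "g n = real n powr (3/2)"

(* only used for n \<ge> 2 *)
definition rho2 :: "nat \<Rightarrow> real" where
  "rho2 n = (g (n-2) - 4 * g (n-1) + 6 * g n - 4 * g (n+1) + g (n+2)) / g n"

definition neg_lap :: "(nat \<Rightarrow> complex) \<Rightarrow> nat \<Rightarrow> complex" where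
  "neg_lap u n = (if n = 0 then 2 * u 0 - u 1 else - u (n-1) + 2 * u n - u (n+1))"

definition H0 :: "nat \<Rightarrow> (nat \<Rightarrow> complex) set" where
  "H0 M = {u. summable (\<lambda>n. (cmod (u n))^2) \<and> (\<forall>k<M. u k = 0)}"

definition lhs :: "(nat \<Rightarrow> complex) \<Rightarrow> real" where
  "lhs u = (\<Sum>n. (cmod (neg_lap u (Suc n)))^2)"

definition rhs :: "(nat \<Rightarrow> complex) \<Rightarrow> real" where
  "rhs u = (\<Sum>n. rho2 (n+2) * (cmod (u (n+2)))^2)"

end

theory Submission
  imports Defs "HOL-Analysis.Harmonic_Numbers"
begin

text \<open>
  Write \<open>u = g v\<close> and \<open>w\<^sub>n = v\<^sub>n\<^sub>+\<^sub>1 - v\<^sub>n\<close>. Expanding each product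
  \<open>v\<^sub>m v\<^sub>n\<close> as \<open>(v\<^sub>m\<^sup>2 + v\<^sub>n\<^sup>2 - (v\<^sub>m - v\<^sub>n)\<^sup>2) / 2\<close> and summing by parts gives an exact identity: the partial
  sum of \<open>|\<Delta>u|\<^sup>2\<close> up to \<open>N\<close> equals the partial sum of \<open>\<rho> |u|\<^sup>2\<close>, plus the sum of
  \<open>c\<^sub>n w\<^sub>n\<^sup>2 + g\<^sub>n\<^sub>-\<^sub>1 g\<^sub>n\<^sub>+\<^sub>1 (w\<^sub>n - w\<^sub>n\<^sub>-\<^sub>1)\<^sup>2\<close>, plus a boundary term at \<open>N\<close> that is a quadratic form in \<open>v\<^sub>N\<close> and
  \<open>v\<^sub>N\<^sub>+\<^sub>1\<close>. For \<open>g = n\<^sup>3\<^sup>/\<^sup>2\<close> both \<open>c\<^sub>n > 0\<close> and the boundary form is nonnegative at every \<open>N\<close>, so no decay of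
  \<open>u\<close> is needed for the inequality; equality forces all \<open>w\<^sub>n\<close> to vanish, hence \<open>u = 0\<close>.

  For optimality take \<open>v\<^sub>n = r\<^sup>n\<close> for \<open>n \<ge> M\<close> and \<open>0\<close> below. Since \<open>c\<^sub>n = O(n)\<close>, the remainder stays bounded as
  \<open>r\<close> tends to \<open>1\<close>, whereas \<open>\<rho>\<^sub>n g\<^sub>n\<^sup>2 \<ge> 1 / (4n)\<close> makes the right-hand side diverge.
\<close>

subsection \<open>Differences of \<open>g\<close>\<close>

lemma g_eq: "g n = real n * sqrt (real n)"
proof (cases "n = 0")
  case False
  have "real n powr (3/2) = real n powr (1 + 1/2)" by simp
  also have "\<dots> = real n * sqrt (real n)"
    using False by (simp only: powr_add) (simp add: powr_half_sqrt)
  finally show ?thesis by (simp add: g_def)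
qed (simp add: g_def)

lemma g_cube: "g n = sqrt (real n) ^ 3"
  by (simp add: g_eq power3_eq_cube)

lemma g_0 [simp]: "g 0 = 0" and g_1 [simp]: "g (Suc 0) = 1"
  by (simp_all add: g_eq)

lemma g_nonneg [simp]: "0 \<le> g n"
  by (simp add: g_eq)

lemma g_pos: "0 < n \<Longrightarrow> 0 < g n"
  by (simp add: g_eq)

lemma g_mono: "m \<le> n \<Longrightarrow> g m \<le> g n"
  by (auto simp: g_eq intro!: mult_mono)

lemma g_square: "(g n)\<^sup>2 = real n ^ 3"
  by (simp add: g_eq power_mult_distrib power3_eq_cube power2_eq_square)

text \<open>Tangent-line inequality for the convex function t^(3/2) at t = s^2, written in terms of
  square roots; the gap has the double root p = s. All estimates for differences of \<open>g\<close>
  rest on it.\<close>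

lemma cube_tangent:
  fixes p s :: real
  assumes "0 \<le> p" "0 \<le> s"
  shows "s ^ 3 + 3/2 * s * (p\<^sup>2 - s\<^sup>2) \<le> p ^ 3"
proof -
  have "p ^ 3 - (s ^ 3 + 3/2 * s * (p\<^sup>2 - s\<^sup>2)) = (p - s)\<^sup>2 * (p + s/2)"
    by (simp add: power2_eq_square power3_eq_cube field_simps)
  moreover have "0 \<le> (p - s)\<^sup>2 * (p + s/2)" using assms by simp
  ultimately show ?thesis by linarith
qed

lemma g_diff_ge: "3/2 * sqrt (real n) \<le> g (Suc n) - g n"
  using cube_tangent[of "sqrt (real (Suc n))" "sqrt (real n)"] by (simp add: g_cube)

lemma g_diff_le: "g (Suc n) - g n \<le> 3/2 * sqrt (real (Suc n))"
  using cube_tangent[of "sqrt (real n)" "sqrt (real (Suc n))"] by (simp add: g_cube)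

definition g_diff2 :: "nat \<Rightarrow> real" where
  "g_diff2 n = g (n - 1) - 2 * g n + g (Suc n)"

lemma g_diff2_nonneg: "0 < n \<Longrightarrow> 0 \<le> g_diff2 n"
  using g_diff_ge[of n] g_diff_le[of "n - 1"] by (simp add: g_diff2_def)

lemma g_diff2_antimono:
  assumes "0 < n"
  shows "g_diff2 (Suc n) \<le> g_diff2 n"
proof -
  obtain k where n: "n = Suc k" using assms by (cases n) auto
  define x where "x = real k + 3/2"
  define s where "s = sqrt (real (k+1)) * sqrt (real (k+2))"
  define p where "p = sqrt (real k) * sqrt (real (k+3))"
  txt \<open>After squaring, the claim becomes convexity of \<open>t \<mapsto> t\<^sup>3\<^sup>/\<^sup>2\<close> at \<open>s\<^sup>2 = (8 x\<^sup>2 + p\<^sup>2) / 9\<close>.\<close>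
  have s2: "s\<^sup>2 = x\<^sup>2 - 1/4" and p2: "p\<^sup>2 = x\<^sup>2 - 9/4"
    by (simp_all add: s_def p_def x_def power_mult_distrib)
       (simp_all add: power2_eq_square field_simps)
  have nn: "0 \<le> s" "0 \<le> p" "0 \<le> x" by (simp_all add: s_def p_def x_def)
  have "8 * (s ^ 3 + 3/2 * s * (x\<^sup>2 - s\<^sup>2)) + (s ^ 3 + 3/2 * s * (p\<^sup>2 - s\<^sup>2)) \<le> 8 * x ^ 3 + p ^ 3"
    using cube_tangent[OF nn(3,1)] cube_tangent[OF nn(2,1)] by (simp only: add_mono mult_left_mono)
  then have key: "9 * s ^ 3 \<le> 8 * x ^ 3 + p ^ 3"
    unfolding s2 p2 by (simp add: algebra_simps)
  have s3: "s ^ 3 = g (k+1) * g (k+2)" and p3: "p ^ 3 = g k * g (k+3)"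
    by (simp_all add: s_def p_def g_cube power_mult_distrib)
  have "(g (k+3) - g k)\<^sup>2 = (g (k+3))\<^sup>2 + (g k)\<^sup>2 - 2 * p ^ 3"
    by (simp add: p3 power2_eq_square algebra_simps)
  \<comment> \<open>Centred at \<open>x\<close>, the cubes add up to 2 x^3 + 27 x / 2 on the left
    and, with the factor 9, to 18 x^3 + 27 x / 2 on the right. The linear parts cancel, and what
    remains is \<open>key\<close> doubled.\<close>
  also have "\<dots> \<le> 9 * ((g (k+2))\<^sup>2 + (g (k+1))\<^sup>2 - 2 * s ^ 3)"
    using key unfolding g_square x_def by (simp add: power3_eq_cube field_simps)
  also have "\<dots> = (3 * (g (k+2) - g (k+1)))\<^sup>2"
    by (simp add: s3 power2_eq_square algebra_simps)
  finally have "g (k+3) - g k \<le> 3 * (g (k+2) - g (k+1))"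
    by (rule power2_le_imp_le) (use g_mono[of "k+1" "k+2"] in simp)
  then show ?thesis by (simp add: g_diff2_def n numeral_eq_Suc)
qed

section \<open>Nonnegativity of the boundary form\<close>

text \<open>The terms are grouped so that, for positive \<open>n\<close>, only the middle one can be
  negative.\<close>

definition boundary_term :: "(nat \<Rightarrow> real) \<Rightarrow> nat \<Rightarrow> real" where
  "boundary_term v n = g_diff2 n * g (n+1) * (v (n+1))\<^sup>2 - g_diff2 (n+1) * g n * (v n)\<^sup>2
     + 2 * g n * (g (n+2) - g (n+1)) * (v (n+1) - v n)\<^sup>2"

text \<open>After multiplication by \<open>\<alpha> + \<tau>\<close> the square in \<open>a\<close>
  is completed; the last hypothesis says that the remaining coefficient of \<open>b\<^sup>2\<close>
  is nonnegative.\<close>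

lemma indefinite_form_nonneg:
  fixes \<alpha> \<beta> \<tau> a b :: real
  assumes "0 \<le> \<alpha>" "0 < \<tau>" "\<alpha> * \<beta> \<le> \<tau> * (\<alpha> - \<beta>)"
  shows "0 \<le> \<alpha> * a\<^sup>2 - \<beta> * b\<^sup>2 + \<tau> * (a - b)\<^sup>2"
proof -
  have "(\<alpha> + \<tau>) * (\<alpha> * a\<^sup>2 - \<beta> * b\<^sup>2 + \<tau> * (a - b)\<^sup>2)
      = ((\<alpha> + \<tau>) * a - \<tau> * b)\<^sup>2 + (\<tau> * (\<alpha> - \<beta>) - \<alpha> * \<beta>) * b\<^sup>2"
    by (simp add: power2_eq_square algebra_simps)
  also have "\<dots> \<ge> 0" using assms by simp
  finally show ?thesis using assms by (simp add: zero_le_mult_iff)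
qed

text \<open>The condition of \<open>indefinite_form_nonneg\<close> for the boundary form, once
  \<open>g_diff2 (n+1)\<close> in \<open>\<alpha> - \<beta>\<close> is replaced by the larger
  \<open>g_diff2 n\<close> and the common factor \<open>g_diff2 n * g n\<close> is removed.\<close>

lemma g_diff2_g_le:
  assumes "0 < n"
  shows "g_diff2 (n+1) * g (n+1) \<le> 2 * (g (n+2) - g (n+1)) * (g (n+1) - g n)"
proof -
  define p where "p = sqrt (real n)"
  define q where "q = sqrt (real n + 1)"
  define t where "t = sqrt (real n + 2)"
  have pos: "0 < p" "0 < q" "p \<le> t" using assms by (simp_all add: p_def q_def t_def)
  have sq: "p\<^sup>2 = real n" "q\<^sup>2 = real n + 1" "t\<^sup>2 = real n + 2"
    by (simp_all add: p_def q_def t_def)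
  have d1: "3/2 * p \<le> g (n+1) - g n" using g_diff_ge[of n] by (simp add: p_def)
  have d2: "3/2 * q \<le> g (n+2) - g (n+1)" using g_diff_ge[of "n+1"] by (simp add: q_def add.commute)
  have d3: "g (n+2) - g (n+1) \<le> 3/2 * t" using g_diff_le[of "n+1"] by (simp add: t_def add.commute)
  have "(t - p) * (2 * p) \<le> (t - p) * (t + p)" using pos by (intro mult_left_mono) auto
  also have "\<dots> = t\<^sup>2 - p\<^sup>2" by (simp add: power2_eq_square algebra_simps)
  finally have tp: "(t - p) * p \<le> 1" using sq by simp
  have "g_diff2 (n+1) \<le> 3/2 * (t - p)" using d1 d3 by (simp add: g_diff2_def)
  then have "g_diff2 (n+1) * p \<le> 3/2 * ((t - p) * p)" using pos by (simp add: mult_right_mono)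
  then have D: "g_diff2 (n+1) * p \<le> 3/2" using tp by linarith
  have "(g_diff2 (n+1) * p) * q ^ 3 \<le> 3/2 * q ^ 3" using D pos by (intro mult_right_mono) auto
  also have "\<dots> = 3/2 * (q * q\<^sup>2)" by (simp add: power2_eq_square power3_eq_cube)
  \<comment> \<open>This is n + 1 \<le> 3 n, valid for n \<ge> 1. The 3 is the quotient of 2
    (3/2)^2, from the two lower bounds \<open>d1\<close> and \<open>d2\<close>, by the 3/2 of
    \<open>D\<close>.\<close>
  also have "\<dots> \<le> 3/2 * (q * (3 * p\<^sup>2))" using pos assms sq by (intro mult_left_mono) auto
  also have "\<dots> = (2 * (3/2 * q) * (3/2 * p)) * p" by (simp add: power2_eq_square)
  also have "\<dots> \<le> (2 * (g (n+2) - g (n+1)) * (g (n+1) - g n)) * p"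
    using d1 d2 pos by (intro mult_right_mono mult_mono mult_left_mono) auto
  finally have "(g_diff2 (n+1) * q ^ 3) * p \<le> (2 * (g (n+2) - g (n+1)) * (g (n+1) - g n)) * p"
    by (simp add: mult_ac)
  moreover have "g (n+1) = q ^ 3" by (simp add: g_cube q_def add.commute)
  ultimately show ?thesis using pos by simp
qed

lemma boundary_term_nonneg:
  assumes "0 < n"
  shows "0 \<le> boundary_term v n"
proof -
  define \<alpha> \<beta> \<tau> where "\<alpha> = g_diff2 n * g (n+1)" "\<beta> = g_diff2 (n+1) * g n" "\<tau> = 2 * g n * (g (n+2) - g (n+1))"
  have g2n: "0 \<le> g_diff2 n" using g_diff2_nonneg assms by simp
  have \<tau>: "0 < \<tau>"
  proof -
    have "0 < 3/2 * sqrt (real (n+1))" by simp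
    also have "\<dots> \<le> g (n+2) - g (n+1)" using g_diff_ge[of "n+1"] by simp
    finally show ?thesis using g_pos[OF assms] by (simp add: \<alpha>_\<beta>_\<tau>_def)
  qed
  have "\<alpha> * \<beta> = g_diff2 n * g n * (g_diff2 (n+1) * g (n+1))" by (simp add: \<alpha>_\<beta>_\<tau>_def mult_ac)
  also have "\<dots> \<le> g_diff2 n * g n * (2 * (g (n+2) - g (n+1)) * (g (n+1) - g n))"
    using g_diff2_g_le[OF assms] g2n by (intro mult_left_mono) auto
  also have "\<dots> = \<tau> * (g_diff2 n * g (n+1) - g_diff2 n * g n)" by (simp add: \<alpha>_\<beta>_\<tau>_def algebra_simps)
  also have "\<dots> \<le> \<tau> * (\<alpha> - \<beta>)"
    using \<tau> g_diff2_antimono[OF assms] unfolding \<alpha>_\<beta>_\<tau>_def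
    by (intro mult_left_mono) (auto intro!: mult_right_mono)
  finally show ?thesis
    unfolding boundary_term_def \<alpha>_\<beta>_\<tau>_def(1-3)[symmetric]
    using indefinite_form_nonneg[of \<alpha> \<tau> \<beta> "v (n+1)" "v n"] \<tau> g2n by (simp add: \<alpha>_\<beta>_\<tau>_def(1))
qed

section \<open>Sign and growth of the remainder coefficient \<open>c\<^sub>n\<close>\<close>

definition rem_coeff :: "nat \<Rightarrow> real" where
  "rem_coeff n = 2 * g (n+1) * (g n - g (n-1)) - 2 * g n * (g (n+2) - g (n+1))"

lemma g_ratio:
  assumes "0 < m"
  shows "g k = g m * ((real k / real m) * sqrt (real k / real m))"
  using assms by (simp add: g_eq real_sqrt_divide)

lemma sqrt_one_minus_le:
  fixes t :: real
  assumes "0 \<le> t" "t \<le> 1"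
  shows "sqrt (1 - t) \<le> 1 - t/2 - t\<^sup>2/8"
proof (rule real_le_lsqrt)
  have t2: "t\<^sup>2 \<le> 1" using assms by (simp add: power_le_one)
  then show "0 \<le> 1 - t/2 - t\<^sup>2/8" using assms by linarith
  have "(1 - t/2 - t\<^sup>2/8)\<^sup>2 - (1 - t) = t ^ 3 / 8 + t ^ 4 / 64"
    by (simp add: power2_eq_square power3_eq_cube power4_eq_xxxx field_simps)
  moreover have "0 \<le> t ^ 3 / 8 + t ^ 4 / 64" using assms by simp
  ultimately show "1 - t \<le> (1 - t/2 - t\<^sup>2/8)\<^sup>2" by linarith
qed

lemma three_halves_le:
  fixes t :: real
  assumes "0 \<le> t" "t \<le> 1"
  shows "(1 - t) * sqrt (1 - t) \<le> 1 - 3/2 * t + 3/8 * t\<^sup>2 + t ^ 3 / 8"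
proof -
  have "(1 - t) * sqrt (1 - t) \<le> (1 - t) * (1 - t/2 - t\<^sup>2/8)"
    using assms sqrt_one_minus_le by (intro mult_left_mono) auto
  then show ?thesis by (simp add: power2_eq_square power3_eq_cube field_simps)
qed

text \<open>Division by \<open>2 * g n * g (n+1)\<close> turns the claim into (1 + s)^(3/2) + (1 -
  t)^(3/2) < 2 with t = 1/n and s = 1/(n+1), where polynomial upper bounds suffice.\<close>

lemma rem_coeff_pos:
  assumes "0 < n"
  shows "0 < rem_coeff n"
proof -
  define t where "t = 1 / real n"
  have t: "0 < t" "t \<le> 1" using assms by (simp_all add: t_def)
  define s where "s = t / (1 + t)"
  have s0: "0 < s" using t by (simp add: s_def)
  have s1: "s = 1 / (real n + 1)" using assms by (simp add: s_def t_def field_simps)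
  have "real (n+2) / real (n+1) = 1 + s" by (simp add: s1 field_simps)
  then have A: "g (n+2) = g (n+1) * ((1 + s) * sqrt (1 + s))"
    using g_ratio[of "n+1" "n+2"] by simp
  have "real (n-1) / real n = 1 - t" using assms by (simp add: t_def of_nat_diff field_simps)
  then have B: "g (n-1) = g n * ((1 - t) * sqrt (1 - t))"
    using g_ratio[of n "n-1"] assms by simp
  have "sqrt (1 + s) \<le> 1 + s/2"
    using s0 by (intro real_le_lsqrt) (auto simp: power2_eq_square algebra_simps)
  then have "(1 + s) * sqrt (1 + s) \<le> (1 + s) * (1 + s/2)"
    using s0 by (intro mult_left_mono) auto
  then have "(1 + s) * sqrt (1 + s) + (1 - t) * sqrt (1 - t)
      \<le> (1 + s) * (1 + s/2) + (1 - 3/2 * t + 3/8 * t\<^sup>2 + t ^ 3 / 8)"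
    using three_halves_le[of t] t by simp
  \<comment> \<open>Since s - t = - t^2 / (1 + t), the first-order terms cancel and a factor t^2
    comes out of the deviation from 2.\<close>
  also have "\<dots> = 2 - t\<^sup>2 / (1 + t)\<^sup>2 * ((5 + 5*t - 5 * t\<^sup>2 - t ^ 3) / 8)"
    using t unfolding s_def by (simp add: divide_simps) (simp add: power2_eq_square power3_eq_cube algebra_simps)
  also have "\<dots> < 2"
  proof -
    have "t\<^sup>2 \<le> t" "t ^ 3 \<le> 1" using t by (simp_all add: power2_eq_square power_le_one mult_left_le)
    then have "0 < 5 + 5*t - 5 * t\<^sup>2 - t ^ 3" by linarith
    then show ?thesis using t by (simp add: zero_less_mult_iff)
  qed
  finally have C: "(1 + s) * sqrt (1 + s) + (1 - t) * sqrt (1 - t) < 2" .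
  have "rem_coeff n = 2 * g n * g (n+1) * (2 - ((1 + s) * sqrt (1 + s) + (1 - t) * sqrt (1 - t)))"
    unfolding rem_coeff_def A B by (simp add: algebra_simps)
  also have "\<dots> > 0" using C g_pos assms by (intro mult_pos_pos) auto
  finally show ?thesis .
qed

text \<open>Both products in \<open>rem_coeff\<close> are of order n^2, but the tangent bounds turn
  their difference into 3 p q (q^2 - p^2), whose last factor is 1. Only linear growth survives,
  which keeps the remainder of the trial functions bounded.\<close>

lemma rem_coeff_le:
  assumes "0 < n"
  shows "rem_coeff n \<le> 3 * real (n+1)"
proof -
  define p where "p = sqrt (real n)"
  define q where "q = sqrt (real n + 1)"
  have pq: "0 \<le> p" "0 \<le> q" "p \<le> q" by (simp_all add: p_def q_def)
  have sq: "p\<^sup>2 = real n" "q\<^sup>2 = real n + 1" by (simp_all add: p_def q_def)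
  have G: "g n = p ^ 3" "g (n+1) = q ^ 3" by (simp_all add: g_cube p_def q_def add.commute)
  have d1: "g n - g (n-1) \<le> 3/2 * p" using g_diff_le[of "n-1"] assms by (simp add: p_def)
  have d2: "3/2 * q \<le> g (n+2) - g (n+1)" using g_diff_ge[of "n+1"] by (simp add: q_def add.commute)
  have "rem_coeff n \<le> 2 * g (n+1) * (3/2 * p) - 2 * g n * (3/2 * q)"
    unfolding rem_coeff_def using d1 d2 by (intro diff_mono mult_left_mono) auto
  also have "\<dots> = 3 * (p * q) * (q\<^sup>2 - p\<^sup>2)"
    unfolding G by (simp add: power2_eq_square power3_eq_cube algebra_simps)
  also have "\<dots> = 3 * (p * q)" by (simp add: sq)
  also have "\<dots> \<le> 3 * (q * q)" using pq by (intro mult_left_mono mult_right_mono) auto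
  finally show ?thesis using sq by (simp add: power2_eq_square)
qed

section \<open>Lower bound for the weight\<close>

definition even32 :: "real \<Rightarrow> real" where
  "even32 y = (1 + y) * sqrt (1 + y) + (1 - y) * sqrt (1 - y)"

text \<open>Squaring leaves the single root \<open>sqrt (1 - y\<^sup>2)\<close>, so that only even powers of \<open>y\<close> have to be estimated.\<close>

lemma even32_square:
  assumes "\<bar>y\<bar> \<le> 1"
  shows "(even32 y)\<^sup>2 = 2 + 6 * y\<^sup>2 + 2 * ((1 - y\<^sup>2) * sqrt (1 - y\<^sup>2))"
proof -
  have "sqrt (1 - y\<^sup>2) = sqrt (1 + y) * sqrt (1 - y)"
    by (simp add: real_sqrt_mult[symmetric] power2_eq_square algebra_simps)
  moreover have "(sqrt (1 + y))\<^sup>2 = 1 + y" "(sqrt (1 - y))\<^sup>2 = 1 - y" using assms by auto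
  moreover have "(even32 y)\<^sup>2 = (1 + y)\<^sup>2 * (sqrt (1 + y))\<^sup>2 + (1 - y)\<^sup>2 * (sqrt (1 - y))\<^sup>2
      + 2 * ((1 - y\<^sup>2) * (sqrt (1 + y) * sqrt (1 - y)))"
    unfolding even32_def by (simp add: power2_eq_square algebra_simps)
  ultimately show ?thesis by (simp add: power2_eq_square algebra_simps)
qed

text \<open>The left side is the Taylor polynomial of degree two. Comparing squares works up to z =
  8/9; beyond that the polynomial itself is nonpositive.\<close>

lemma three_halves_ge:
  fixes z :: real
  assumes "0 \<le> z" "z \<le> 1"
  shows "1 - 3/2 * z + 3/8 * z\<^sup>2 \<le> (1 - z) * sqrt (1 - z)"
proof (cases "z \<le> 8/9")
  case True
  have "(1 - z) ^ 3 - (1 - 3/2 * z + 3/8 * z\<^sup>2)\<^sup>2 = z ^ 3 / 64 * (8 - 9 * z)"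
    by (simp add: power2_eq_square power3_eq_cube field_simps)
  also have "\<dots> \<ge> 0" using True assms by simp
  finally have "(1 - 3/2 * z + 3/8 * z\<^sup>2)\<^sup>2 \<le> (1 - z) ^ 3" by simp
  also have "\<dots> = ((1 - z) * sqrt (1 - z))\<^sup>2"
    using assms by (simp add: power_mult_distrib) (simp add: power3_eq_cube power2_eq_square)
  finally have "(1 - 3/2 * z + 3/8 * z\<^sup>2)\<^sup>2 \<le> ((1 - z) * sqrt (1 - z))\<^sup>2" .
  then show ?thesis by (rule power2_le_imp_le) (use assms in simp)
next
  case False
  have "z\<^sup>2 \<le> z" using assms by (simp add: power2_eq_square mult_left_le)
  then have "1 - 3/2 * z + 3/8 * z\<^sup>2 \<le> 0" using False by linarith
  also have "\<dots> \<le> (1 - z) * sqrt (1 - z)" using assms by simp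
  finally show ?thesis .
qed

text \<open>The quartic Taylor coefficient of \<open>even32\<close> at 0 is 3/64; the 1/32 here and
  the 1/16 in \<open>even32_le\<close> bracket it. The range reaches 1 because \<open>rho2 2\<close>
  involves \<open>even32 1\<close>.\<close>

lemma even32_ge:
  assumes "\<bar>y\<bar> \<le> 1"
  shows "2 + 3/4 * y\<^sup>2 + y ^ 4 / 32 \<le> even32 y"
proof -
  define z where "z = y\<^sup>2"
  have z: "0 \<le> z" "z \<le> 1" using assms by (auto simp: z_def abs_square_le_1)
  have z3: "z ^ 3 \<le> z\<^sup>2" "z ^ 4 \<le> z\<^sup>2" using z by (auto intro: power_decreasing)
  have "(2 + 3/4 * z + z\<^sup>2 / 32)\<^sup>2 = 4 + 3 * z + 11/16 * z\<^sup>2 + 3/64 * z ^ 3 + z ^ 4 / 1024"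
    by (simp add: power2_eq_square power3_eq_cube power4_eq_xxxx field_simps)
  also have "\<dots> \<le> 2 + 6 * z + 2 * (1 - 3/2 * z + 3/8 * z\<^sup>2)" 
    
  proof -
    \<comment> \<open>With the powers of \<open>z\<close> replaced by variables the estimate is
      linear.\<close>
    have "4 + 3 * z + 11/16 * a + 3/64 * b + c / 1024 \<le> 2 + 6 * z + 2 * (1 - 3/2 * z + 3/8 * a)"
      if "b \<le> a" "c \<le> a" "0 \<le> a" for a b c :: real
      using that by (simp add: field_simps)
    then show ?thesis by this (use z3 in auto)
  qed
  also have "\<dots> \<le> 2 + 6 * z + 2 * ((1 - z) * sqrt (1 - z))" using three_halves_ge[OF z] by simp
  also have "\<dots> = (even32 y)\<^sup>2" using even32_square[OF assms] by (simp add: z_def)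
  finally have "2 + 3/4 * z + z\<^sup>2 / 32 \<le> even32 y"
    by (rule power2_le_imp_le) (use assms in \<open>simp add: even32_def\<close>)
  then show ?thesis by (simp add: z_def)
qed

lemma even32_le:
  assumes "\<bar>y\<bar> \<le> 1/2"
  shows "even32 y \<le> 2 + 3/4 * y\<^sup>2 + y ^ 4 / 16"
proof -
  define z where "z = y\<^sup>2"
  have "\<bar>y\<bar>\<^sup>2 \<le> (1/2)\<^sup>2" using assms by (intro power_mono) auto
  then have z: "0 \<le> z" "z \<le> 1/4" by (simp_all add: z_def power2_eq_square)
  have z3: "z ^ 3 \<le> z\<^sup>2 / 4"
    using mult_left_mono[OF z(2), of "z\<^sup>2"] by (simp add: power3_eq_cube power2_eq_square)
  have "(even32 y)\<^sup>2 = 2 + 6 * z + 2 * ((1 - z) * sqrt (1 - z))"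
    using even32_square[of y] assms by (simp add: z_def)
  also have "\<dots> \<le> 2 + 6 * z + 2 * (1 - 3/2 * z + 3/8 * z\<^sup>2 + z ^ 3 / 8)"
    using three_halves_le[of z] z by simp
  also have "\<dots> \<le> 4 + 3 * z + 13/16 * z\<^sup>2 + 3/32 * z ^ 3 + z ^ 4 / 256" 
    
  proof -
    have "2 + 6 * z + 2 * (1 - 3/2 * z + 3/8 * a + b / 8) \<le> 4 + 3 * z + 13/16 * a + 3/32 * b + c / 256"
      if "b \<le> a / 4" "0 \<le> a" "0 \<le> c" for a b c :: real
      using that by (simp add: field_simps)
    then show ?thesis by this (use z3 z in auto)
  qed
  also have "\<dots> = (2 + 3/4 * z + z\<^sup>2 / 16)\<^sup>2"
    by (simp add: power2_eq_square power3_eq_cube power4_eq_xxxx field_simps)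
  finally have "even32 y \<le> 2 + 3/4 * z + z\<^sup>2 / 16"
    by (rule power2_le_imp_le) (use z in simp)
  then show ?thesis by (simp add: z_def)
qed

text \<open>With x = 1/n the weight is \<open>6 - 4 * even32 x + even32 (2 * x)\<close>. Constant
  and quadratic terms cancel, and the quartic bounds leave 16/32 - 4/16 = 1/4.\<close>

lemma rho2_ge:
  assumes "2 \<le> n"
  shows "1 / (4 * real n ^ 4) \<le> rho2 n"
proof -
  define x where "x = 1 / real n"
  have x: "0 < x" "x \<le> 1/2" using assms by (simp_all add: x_def field_simps)
  have r: "real (n-2) / real n = 1 - 2*x" "real (n-1) / real n = 1 - x"
    "real (n+1) / real n = 1 + x" "real (n+2) / real n = 1 + 2*x"
    using assms by (simp_all add: x_def of_nat_diff field_simps)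
  have G: "g (n-2) = g n * ((1 - 2*x) * sqrt (1 - 2*x))" "g (n-1) = g n * ((1 - x) * sqrt (1 - x))"
    "g (n+1) = g n * ((1 + x) * sqrt (1 + x))" "g (n+2) = g n * ((1 + 2*x) * sqrt (1 + 2*x))"
    using g_ratio[of n "n-2"] g_ratio[of n "n-1"] g_ratio[of n "n+1"] g_ratio[of n "n+2"] assms
    unfolding r by simp_all
  have "g (n-2) - 4 * g (n-1) + 6 * g n - 4 * g (n+1) + g (n+2)
      = g n * (6 - 4 * even32 x + even32 (2 * x))"
    unfolding G even32_def by (simp add: algebra_simps)
  then have "rho2 n = 6 - 4 * even32 x + even32 (2 * x)"
    using g_pos[of n] assms by (simp add: rho2_def)
  moreover have "even32 x \<le> 2 + 3/4 * x\<^sup>2 + x ^ 4 / 16" using even32_le[of x] x by simp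
  moreover have "2 + 3 * x\<^sup>2 + x ^ 4 / 2 \<le> even32 (2 * x)"
    using even32_ge[of "2*x"] x by (simp add: power_mult_distrib)
  ultimately have "x ^ 4 / 4 \<le> rho2 n" by linarith
  then show ?thesis by (simp add: x_def power_divide)
qed

lemma rho2_pos: "2 \<le> n \<Longrightarrow> 0 < rho2 n"
  by (rule less_le_trans[OF _ rho2_ge]) auto

subsection \<open>The Rellich identity\<close>

text \<open>Centred at \<open>n+1\<close>, so that it matches \<open>neg_lap\<close> at
  \<open>Suc n\<close> up to sign.\<close>

definition second_diff :: "(nat \<Rightarrow> real) \<Rightarrow> nat \<Rightarrow> real" where
  "second_diff a n = a n - 2 * a (n+1) + a (n+2)"

text \<open>Both sums cover the centres up to \<open>N+1\<close>. The second starts at centre 2, the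
  weight at centre 1 being \<open>g 0 * g 2 = 0\<close>.\<close>

definition remainder_sum :: "(nat \<Rightarrow> real) \<Rightarrow> nat \<Rightarrow> real" where
  "remainder_sum v N = (\<Sum>i\<le>N. rem_coeff (i+1) * (v (i+2) - v (i+1))\<^sup>2)
     + (\<Sum>i<N. g (i+1) * g (i+3) * (v (i+3) - 2 * v (i+2) + v (i+1))\<^sup>2)"

text \<open>Here \<open>a\<close> to \<open>e\<close> stand for \<open>g N\<close> to
  \<open>g (N+4)\<close>, and \<open>x\<close>, \<open>y\<close>, \<open>z\<close> for
  \<open>v (N+1)\<close> to \<open>v (N+3)\<close>. The last group on each side is the boundary
  term, at \<open>N+1\<close> and at \<open>N+2\<close>, so the identity telescopes.\<close>

lemma rellich_step:
  fixes a b c d e x y z :: real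
  shows "(b * x - 2 * (c * y) + d * z)\<^sup>2
      + ((a - 2 * b + c) * c * y\<^sup>2 - (b - 2 * c + d) * b * x\<^sup>2 + 2 * b * (d - c) * (y - x)\<^sup>2)
    = (a - 4 * b + 6 * c - 4 * d + e) * c * y\<^sup>2
      + (2 * d * (c - b) - 2 * c * (e - d)) * (z - y)\<^sup>2 + b * d * (z - 2 * y + x)\<^sup>2
      + ((b - 2 * c + d) * d * z\<^sup>2 - (c - 2 * d + e) * c * y\<^sup>2 + 2 * c * (e - d) * (z - y)\<^sup>2)"
  by (simp add: power2_eq_square algebra_simps)

lemma rellich_identity:
  assumes "v 1 = 0"
  shows "(\<Sum>i\<le>N. (second_diff (\<lambda>n. g n * v n) i)\<^sup>2)
    = (\<Sum>i<N. rho2 (i+2) * (g (i+2) * v (i+2))\<^sup>2) + remainder_sum v N + boundary_term v (N+1)"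
proof (induction N)
  \<comment> \<open>As \<open>g 0 = 0\<close> and \<open>v 1 = 0\<close>, both sides equal
    \<open>(g 2 * v 2)\<^sup>2\<close>.\<close>
  case 0
  then show ?case using assms
    by (simp add: second_diff_def remainder_sum_def boundary_term_def rem_coeff_def g_diff2_def
        eval_nat_numeral algebra_simps)
next
  case (Suc N)
  have nz: "g (N+2) \<noteq> 0" using g_pos[of "N+2"] by simp
  have rho: "rho2 (N+2) * (g (N+2) * v (N+2))\<^sup>2
     = (g N - 4 * g (N+1) + 6 * g (N+2) - 4 * g (N+3) + g (N+4)) * g (N+2) * (v (N+2))\<^sup>2"
    using nz by (simp add: rho2_def power2_eq_square numeral_eq_Suc)
  have sh: "Suc N + 1 = N+2" "Suc N + 2 = N+3" "Suc N + 3 = N + 4" by auto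
  have e: "g_diff2 (N+1) = g N - 2 * g (N+1) + g (N+2)" "g_diff2 (N+2) = g (N+1) - 2 * g (N+2) + g (N+3)"
     "g_diff2 (N+3) = g (N+2) - 2 * g (N+3) + g (N+4)"
     "rem_coeff (N+2) = 2 * g (N+3) * (g (N+2) - g (N+1)) - 2 * g (N+2) * (g (N+4) - g (N+3))"
     by (simp_all add: g_diff2_def rem_coeff_def numeral_eq_Suc)
  have b: "boundary_term v (N+1) = g_diff2 (N+1) * g (N+2) * (v (N+2))\<^sup>2 - g_diff2 (N+2) * g (N+1) * (v (N+1))\<^sup>2
     + 2 * g (N+1) * (g (N+3) - g (N+2)) * (v (N+2) - v (N+1))\<^sup>2"
    "boundary_term v (N+2) = g_diff2 (N+2) * g (N+3) * (v (N+3))\<^sup>2 - g_diff2 (N+3) * g (N+2) * (v (N+2))\<^sup>2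
     + 2 * g (N+2) * (g (N+4) - g (N+3)) * (v (N+3) - v (N+2))\<^sup>2"
    by (simp_all add: boundary_term_def numeral_eq_Suc)
  have l: "second_diff (\<lambda>n. g n * v n) (Suc N) = g (N+1) * v (N+1) - 2 * (g (N+2) * v (N+2)) + g (N+3) * v (N+3)"
    by (simp add: second_diff_def numeral_eq_Suc)
  have step: "(second_diff (\<lambda>n. g n * v n) (Suc N))\<^sup>2 + boundary_term v (N+1)
    = rho2 (N+2) * (g (N+2) * v (N+2))\<^sup>2 + rem_coeff (N+2) * (v (N+3) - v (N+2))\<^sup>2
      + g (N+1) * g (N+3) * (v (N+3) - 2 * v (N+2) + v (N+1))\<^sup>2 + boundary_term v (N+2)"
    unfolding rho b e l by (rule rellich_step)
  have R: "remainder_sum v (Suc N) = remainder_sum v N + rem_coeff (N+2) * (v (N+3) - v (N+2))\<^sup>2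
      + g (N+1) * g (N+3) * (v (N+3) - 2 * v (N+2) + v (N+1))\<^sup>2"
    by (simp add: remainder_sum_def numeral_eq_Suc)
  show ?case unfolding sum.atMost_Suc sum.lessThan_Suc R Suc.IH sh using step by simp
qed

section \<open>The inequality and its equality case\<close>

text \<open>A single remainder term is kept, from which the equality case will be read off.\<close>

lemma remainder_sum_ge:
  assumes "k \<le> N"
  shows "rem_coeff (k+1) * (v (k+2) - v (k+1))\<^sup>2 \<le> remainder_sum v N"
proof -
  have "rem_coeff (k+1) * (v (k+2) - v (k+1))\<^sup>2 \<le> (\<Sum>i\<le>N. rem_coeff (i+1) * (v (i+2) - v (i+1))\<^sup>2)"
    using assms rem_coeff_pos by (intro member_le_sum) (auto simp: less_imp_le)
  moreover have "0 \<le> (\<Sum>i<N. g (i+1) * g (i+3) * (v (i+3) - 2 * v (i+2) + v (i+1))\<^sup>2)"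
    by (intro sum_nonneg) simp
  ultimately show ?thesis by (simp add: remainder_sum_def)
qed

lemma rellich_partial:
  fixes a :: "nat \<Rightarrow> real"
  assumes "a 0 = 0" "a 1 = 0" "k \<le> N"
  shows "(\<Sum>i<N. rho2 (i+2) * (a (i+2))\<^sup>2) + rem_coeff (k+1) * (a (k+2) / g (k+2) - a (k+1) / g (k+1))\<^sup>2
    \<le> (\<Sum>i\<le>N. (second_diff a i)\<^sup>2)"
proof -
  define v where "v n = a n / g n" for n
  \<comment> \<open>At index 0, where \<open>g\<close> vanishes, this is the assumption
    \<open>a 0 = 0\<close>.\<close>
  have a: "a n = g n * v n" for n
    using assms(1) g_pos[of n] by (cases "n = 0") (simp_all add: v_def)
  have "v 1 = 0" using assms by (simp add: v_def)
  from rellich_identity[of v N, OF this] remainder_sum_ge[OF assms(3), of v] boundary_term_nonneg[of "N+1" v]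
  show ?thesis by (simp add: a[symmetric] flip: v_def)
qed

lemma neg_lap_Suc_norm:
  "(cmod (neg_lap u (Suc n)))\<^sup>2 = (second_diff (\<lambda>n. Re (u n)) n)\<^sup>2 + (second_diff (\<lambda>n. Im (u n)) n)\<^sup>2"
  unfolding cmod_power2 neg_lap_def second_diff_def
  by (simp add: power2_eq_square algebra_simps)

lemma rellich_partial_complex:
  fixes u :: "nat \<Rightarrow> complex"
  assumes "u 0 = 0" "u 1 = 0" "k \<le> N"
  shows "(\<Sum>i<N. rho2 (i+2) * (cmod (u (i+2)))\<^sup>2)
      + rem_coeff (k+1) * (cmod (u (k+2) / of_real (g (k+2)) - u (k+1) / of_real (g (k+1))))\<^sup>2
    \<le> (\<Sum>i\<le>N. (cmod (neg_lap u (Suc i)))\<^sup>2)"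
proof -
  have "(\<Sum>i<N. rho2 (i+2) * (cmod (u (i+2)))\<^sup>2) = (\<Sum>i<N. rho2 (i+2) * (Re (u (i+2)))\<^sup>2)
      + (\<Sum>i<N. rho2 (i+2) * (Im (u (i+2)))\<^sup>2)"
    by (simp add: cmod_power2 distrib_left sum.distrib)
  moreover have "(\<Sum>i\<le>N. (cmod (neg_lap u (Suc i)))\<^sup>2)
      = (\<Sum>i\<le>N. (second_diff (\<lambda>n. Re (u n)) i)\<^sup>2) + (\<Sum>i\<le>N. (second_diff (\<lambda>n. Im (u n)) i)\<^sup>2)"
    by (simp add: neg_lap_Suc_norm sum.distrib)
  moreover have "rem_coeff (k+1) * (cmod (u (k+2) / of_real (g (k+2)) - u (k+1) / of_real (g (k+1))))\<^sup>2
      = rem_coeff (k+1) * (Re (u (k+2)) / g (k+2) - Re (u (k+1)) / g (k+1))\<^sup>2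
      + rem_coeff (k+1) * (Im (u (k+2)) / g (k+2) - Im (u (k+1)) / g (k+1))\<^sup>2"
    by (simp add: cmod_power2 distrib_left Re_divide_of_real Im_divide_of_real)
  ultimately show ?thesis
    using rellich_partial[of "\<lambda>n. Re (u n)" k N] rellich_partial[of "\<lambda>n. Im (u n)" k N] assms by simp
qed

text \<open>The retained remainder term does not depend on \<open>N\<close> and therefore survives
  the limit; the same bound on partial sums of nonnegative terms yields summability.\<close>

lemma rellich_strong:
  assumes "u 0 = 0" "u 1 = 0" "summable (\<lambda>n. (cmod (neg_lap u (Suc n)))\<^sup>2)"
  shows "summable (\<lambda>n. rho2 (n+2) * (cmod (u (n+2)))\<^sup>2)"
    and "rhs u + rem_coeff (k+1) * (cmod (u (k+2) / of_real (g (k+2)) - u (k+1) / of_real (g (k+1))))\<^sup>2 \<le> lhs u"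
proof -
  let ?c = "\<lambda>k. rem_coeff (k+1) * (cmod (u (k+2) / of_real (g (k+2)) - u (k+1) / of_real (g (k+1))))\<^sup>2"
  have bound: "(\<Sum>i<N. rho2 (i+2) * (cmod (u (i+2)))\<^sup>2) + ?c k \<le> lhs u" if "k \<le> N" for k N
    using order_trans[OF rellich_partial_complex[OF assms(1,2) that] sum_le_suminf[OF assms(3), of "{..N}"]]
    by (simp add: lhs_def)
  have rem_nonneg: "0 \<le> ?c k" for k
    by (rule mult_nonneg_nonneg) (simp_all add: rem_coeff_pos less_imp_le)
  have nn: "0 \<le> rho2 (i+2) * (cmod (u (i+2)))\<^sup>2" for i using rho2_pos[of "i+2"] by simp
  have "(\<Sum>i<N. rho2 (i+2) * (cmod (u (i+2)))\<^sup>2) \<le> lhs u" for N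
    using order_trans[OF _ bound[of 0 N]] rem_nonneg[of 0] by simp
  then show s: "summable (\<lambda>n. rho2 (n+2) * (cmod (u (n+2)))\<^sup>2)"
    using nn by (intro summableI_nonneg_bounded)
  have "(\<lambda>N. (\<Sum>i<N. rho2 (i+2) * (cmod (u (i+2)))\<^sup>2) + ?c k) \<longlonglongrightarrow> rhs u + ?c k"
    unfolding rhs_def by (intro tendsto_add summable_LIMSEQ s tendsto_const)
  then show "rhs u + ?c k \<le> lhs u"
    by (rule LIMSEQ_le_const2) (use bound in blast)
qed

lemma summable_neg_lap:
  assumes "summable (\<lambda>n. (cmod (u n))\<^sup>2)"
  shows "summable (\<lambda>n. (cmod (neg_lap u (Suc n)))\<^sup>2)"
proof (rule summable_comparison_test')
  show "summable (\<lambda>n. 6 * (cmod (u n))\<^sup>2 + 12 * (cmod (u (n+1)))\<^sup>2 + 6 * (cmod (u (n+2)))\<^sup>2)"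
    using assms by (intro summable_add summable_mult) (auto simp only: summable_iff_shift[of "\<lambda>n. (cmod (u n))\<^sup>2"])
  fix n :: nat
  define x y z where "x = cmod (u n)" "y = cmod (u (n+1))" "z = cmod (u (n+2))"
  have "neg_lap u (Suc n) = - u n + 2 * u (n+1) - u (n+2)" by (simp add: neg_lap_def)
  then have "cmod (neg_lap u (Suc n)) \<le> x + 2 * y + z"
    unfolding x_y_z_def
    using norm_triangle_ineq4[of "- u n + 2 * u (n+1)" "u (n+2)"] norm_triangle_ineq[of "- u n" "2 * u (n+1)"]
    by (simp add: norm_mult)
  then have "(cmod (neg_lap u (Suc n)))\<^sup>2 \<le> (x + 2 * y + z)\<^sup>2" by (intro power_mono) auto
  also have "\<dots> \<le> 6 * x\<^sup>2 + 12 * y\<^sup>2 + 6 * z\<^sup>2"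
  proof -
    have "6 * x\<^sup>2 + 12 * y\<^sup>2 + 6 * z\<^sup>2 - (x + 2 * y + z)\<^sup>2
        = 2 * (x - y)\<^sup>2 + 2 * (y - z)\<^sup>2 + (x - z)\<^sup>2 + 2 * x\<^sup>2 + 4 * y\<^sup>2 + 2 * z\<^sup>2"
      by (simp add: power2_eq_square algebra_simps)
    moreover have "0 \<le> 2 * (x - y)\<^sup>2 + 2 * (y - z)\<^sup>2 + (x - z)\<^sup>2 + 2 * x\<^sup>2 + 4 * y\<^sup>2 + 2 * z\<^sup>2"
      by simp
    ultimately show ?thesis by linarith
  qed
  finally show "norm ((cmod (neg_lap u (Suc n)))\<^sup>2)
      \<le> 6 * (cmod (u n))\<^sup>2 + 12 * (cmod (u (n+1)))\<^sup>2 + 6 * (cmod (u (n+2)))\<^sup>2"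
    by (simp add: x_y_z_def)
qed

lemma H0_props:
  assumes "u \<in> H0 M" "2 \<le> M"
  shows "u 0 = 0" "u 1 = 0" "summable (\<lambda>n. (cmod (neg_lap u (Suc n)))\<^sup>2)"
  using assms summable_neg_lap[of u] by (auto simp: H0_def)

lemma rellich_ge:
  assumes "u \<in> H0 M" "2 \<le> M"
  shows "rhs u \<le> lhs u"
  by (rule order_trans[OF _ rellich_strong(2)[OF H0_props[OF assms], of 0]])
     (simp add: rem_coeff_pos less_imp_le)

lemma rhs_pos:
  assumes "u \<in> H0 M" "2 \<le> M" "u \<noteq> (\<lambda>n. 0)"
  shows "0 < rhs u"
proof -
  obtain n where n: "u n \<noteq> 0" using assms(3) by auto
  then have "n \<ge> 2" using H0_props(1,2)[OF assms(1,2)] by (cases n; cases "n - 1") auto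
  then have "u (n - 2 + 2) \<noteq> 0" using n by (simp only: le_add_diff_inverse2 not_False_eq_True)
  then have "0 < rho2 (n-2+2) * (cmod (u (n-2+2)))\<^sup>2" using rho2_pos[of "n-2+2"] by simp
  moreover have "0 \<le> rho2 (i+2) * (cmod (u (i+2)))\<^sup>2" for i using rho2_pos[of "i+2"] by simp
  ultimately show ?thesis
    unfolding rhs_def by (intro suminf_pos2[OF rellich_strong(1)[OF H0_props[OF assms(1,2)]]])
qed

text \<open>Equality annihilates every remainder term, so u/g is constant from index 1 on, and
  \<open>u 1 = 0\<close> makes that constant zero.\<close>

lemma equality_imp_zero:
  assumes "u 0 = 0" "u 1 = 0" "summable (\<lambda>n. (cmod (neg_lap u (Suc n)))\<^sup>2)" "lhs u = rhs u"
  shows "u = (\<lambda>n. 0)"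
proof -
  have step: "u (k+2) / of_real (g (k+2)) = u (k+1) / of_real (g (k+1))" for k
  proof (rule ccontr)
    assume "\<not> ?thesis"
    then have "0 < rem_coeff (k+1) * (cmod (u (k+2) / of_real (g (k+2)) - u (k+1) / of_real (g (k+1))))\<^sup>2"
      using rem_coeff_pos[of "k+1"] by simp
    then show False using rellich_strong(2)[OF assms(1-3), of k] assms(4) by simp
  qed
  have "u (k+1) = 0" for k
  proof (induction k)
    case (Suc k)
    have "g (k+2) \<noteq> 0" using g_pos[of "k+2"] by simp
    then show ?case using step[of k] Suc by simp
  qed (use assms in simp)
  then have "u n = 0" for n using assms(1) by (cases n) auto
  then show ?thesis by blast
qed

subsection \<open>Optimality\<close>

text \<open>Summation by parts gives (1 - x) S_j = j S_(j-1) minus a nonnegative end term for j = 1,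
  2, 3. The bounds are the values of the full series.\<close>

lemma sum_geometric_weighted_le:
  fixes x :: real
  assumes "0 \<le> x" "x < 1"
  shows "(\<Sum>m<N. (real m + 1) * x ^ m) \<le> 1 / (1 - x) ^ 2"
    and "(\<Sum>m<N. (real m + 1) * (real m + 2) * (real m + 3) * x ^ m) \<le> 6 / (1 - x) ^ 4"
proof -
  define S0 S1 S2 S3 where "S0 = (\<Sum>m<N. x ^ m)" "S1 = (\<Sum>m<N. (real m + 1) * x ^ m)"
    "S2 = (\<Sum>m<N. (real m + 1) * (real m + 2) * x ^ m)"
    "S3 = (\<Sum>m<N. (real m + 1) * (real m + 2) * (real m + 3) * x ^ m)"
  note defs = S0_S1_S2_S3_def
  have "(1 - x) * S0 = 1 - x ^ N"
    unfolding defs by (rule one_diff_power_eq[symmetric])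
  moreover have "(1 - x) * S1 = S0 - real N * x ^ N"
    unfolding defs
    by (induction N) (simp, simp only: sum.lessThan_Suc distrib_left[of "1 - x"], simp add: algebra_simps)
  moreover have "(1 - x) * S2 = 2 * S1 - real N * (real N + 1) * x ^ N"
    unfolding defs
    by (induction N) (simp, simp only: sum.lessThan_Suc distrib_left[of "1 - x"], simp add: algebra_simps)
  moreover have "(1 - x) * S3 = 3 * S2 - real N * (real N + 1) * (real N + 2) * x ^ N"
    unfolding defs
    by (induction N) (simp, simp only: sum.lessThan_Suc distrib_left[of "1 - x"], simp add: algebra_simps)
  ultimately have "(1 - x) * S0 \<le> 1" "(1 - x) * S1 \<le> S0" "(1 - x) * S2 \<le> 2 * S1" "(1 - x) * S3 \<le> 3 * S2"
    using assms by simp_all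
  then have b: "S0 \<le> 1 / (1 - x)" "S1 \<le> S0 / (1 - x)" "S2 \<le> 2 * S1 / (1 - x)" "S3 \<le> 3 * S2 / (1 - x)"
    using assms by (simp_all add: field_simps)
  have "S0 / (1 - x) \<le> (1 / (1 - x)) / (1 - x)" using b(1) assms by (intro divide_right_mono) auto
  with b(2) show 1: "S1 \<le> 1 / (1 - x) ^ 2" by (simp add: power2_eq_square)
  have "2 * S1 / (1 - x) \<le> 2 * (1 / (1 - x) ^ 2) / (1 - x)"
    using 1 assms by (intro divide_right_mono) auto
  with b(3) have 2: "S2 \<le> 2 / (1 - x) ^ 3" by (simp add: power2_eq_square power3_eq_cube)
  have "3 * S2 / (1 - x) \<le> 3 * (2 / (1 - x) ^ 3) / (1 - x)"
    using 2 assms by (intro divide_right_mono) auto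
  with b(4) show "S3 \<le> 6 / (1 - x) ^ 4" by (simp add: power4_eq_xxxx power3_eq_cube)
qed

lemma summable_cubic_geometric:
  fixes x :: real
  assumes "0 \<le> x" "x < 1"
  shows "summable (\<lambda>n. (real n + 1) * (real n + 2) * (real n + 3) * x ^ n)"
  using assms sum_geometric_weighted_le(2)[OF assms] by (intro summableI_nonneg_bounded) auto

lemma g_prod_le: "g n * g (n+2) \<le> (real n + 1) ^ 3"
proof (rule power2_le_imp_le)
  have "(g n * g (n+2))\<^sup>2 = (real n * (real n + 2)) ^ 3"
    by (simp add: power_mult_distrib g_square add.commute)
  also have "\<dots> \<le> ((real n + 1)\<^sup>2) ^ 3"
    by (intro power_mono) (auto simp: power2_eq_square algebra_simps)
  finally show "(g n * g (n+2))\<^sup>2 \<le> ((real n + 1) ^ 3)\<^sup>2" by (simp add: power_mult[symmetric])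
qed simp

section \<open>Truncated geometric trial functions\<close>

definition trial_profile :: "nat \<Rightarrow> real \<Rightarrow> nat \<Rightarrow> real" where
  "trial_profile M r n = (if n < M then 0 else r ^ n)"

lemma trial_profile_bounds:
  assumes "0 < r" "r < 1"
  shows "0 \<le> trial_profile M r n" "trial_profile M r n \<le> 1"
  using assms by (simp_all add: trial_profile_def power_le_one)

text \<open>The bound is uniform in \<open>r\<close> and \<open>N\<close>. Indices below
  \<open>M\<close> are estimated crudely by \<open>h\<close> and \<open>k\<close>; from
  \<open>M\<close> on, first and second differences carry factors 1 - r and (1 - r)^2, whose squares
  offset the growth of the weighted geometric sums because 1 - r \<le> 1 - r^2. The 18 is 6 * 1 + 2
  * 6.\<close>

lemma remainder_sum_trial_profile_le:
  assumes "0 < r" "r < 1"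
  shows "remainder_sum (trial_profile M r) N \<le> (\<Sum>i<M. 3 * (real i + 2) + 4 * (real i + 2) ^ 3) + 18"
proof -
  define v x where "v = trial_profile M r" "x = r\<^sup>2"
  note v_def = v_x_def(1)
  have x: "0 \<le> x" "x < 1" using assms by (simp_all add: v_x_def(2) abs_square_less_1)
  have v: "0 \<le> v n" "v n \<le> 1" for n using trial_profile_bounds[OF assms] by (simp_all add: v_def)
  have one_x: "1 - r \<le> 1 - x" "0 < 1 - x" "0 < 1 - r"
    using assms x by (simp_all add: v_x_def(2) power2_eq_square)
  define h where "h i = (if i < M then 3 * (real i + 2) else 0)" for i
  define k where "k i = (if i < M then 4 * (real i + 2) ^ 3 else 0)" for i
  have cut: "(\<Sum>i<K. if i < M then f i else 0) \<le> (\<Sum>i<M. f i)" if "\<And>i. 0 \<le> f i" for f :: "nat \<Rightarrow> real" and K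
  proof -
    have "(\<Sum>i<K. if i < M then f i else 0) = (\<Sum>i\<in>{i\<in>{..<K}. i < M}. f i)"
      by (subst sum.inter_filter) auto
    also have "\<dots> \<le> (\<Sum>i<M. f i)" using that by (intro sum_mono2) auto
    finally show ?thesis .
  qed
  have A: "rem_coeff (i+1) * (v (i+2) - v (i+1))\<^sup>2 \<le> h i + 6 * (1 - r)\<^sup>2 * ((real i + 1) * x ^ i)" for i
  proof (cases "i < M")
    case True
    have "\<bar>v (i+2) - v (i+1)\<bar> \<le> 1" using v[of "i+1"] v[of "i+2"] by linarith
    then have "(v (i+2) - v (i+1))\<^sup>2 \<le> 1" by (simp add: abs_square_le_1)
    then have "rem_coeff (i+1) * (v (i+2) - v (i+1))\<^sup>2 \<le> rem_coeff (i+1) * 1"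
      by (intro mult_left_mono) (simp_all add: rem_coeff_pos less_imp_le)
    also have "\<dots> \<le> h i" using rem_coeff_le[of "i+1"] True by (simp add: h_def)
    also have "\<dots> \<le> h i + 6 * (1 - r)\<^sup>2 * ((real i + 1) * x ^ i)" using x by simp
    finally show ?thesis .
  next
    case False
    then have "v (i+2) - v (i+1) = - (r * (1 - r) * r ^ i)" by (simp add: v_def trial_profile_def algebra_simps)
    then have "(v (i+2) - v (i+1))\<^sup>2 = x * ((1 - r)\<^sup>2 * x ^ i)"
      by (simp add: v_x_def(2) power_mult_distrib power_mult[symmetric] mult.commute)
    also have "\<dots> \<le> 1 * ((1 - r)\<^sup>2 * x ^ i)" using x by (intro mult_right_mono) auto
    finally have "rem_coeff (i+1) * (v (i+2) - v (i+1))\<^sup>2 \<le> (3 * (real i + 2)) * ((1 - r)\<^sup>2 * x ^ i)"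
      using rem_coeff_le[of "i+1"] x by (intro mult_mono) auto
    also have "\<dots> \<le> (6 * (real i + 1)) * ((1 - r)\<^sup>2 * x ^ i)" using x by (intro mult_right_mono) auto
    finally show ?thesis using False by (simp add: h_def algebra_simps)
  qed
  have B: "g (i+1) * g (i+3) * (v (i+3) - 2 * v (i+2) + v (i+1))\<^sup>2
      \<le> k i + 2 * (1 - r) ^ 4 * ((real i + 1) * (real i + 2) * (real i + 3) * x ^ i)" for i
  proof -
    have G: "g (i+1) * g (i+3) \<le> (real i + 2) ^ 3"
      using g_prod_le[of "i+1"] by (simp add: add.commute eval_nat_numeral)
    show ?thesis
    proof (cases "i < M")
      case True
      have "\<bar>v (i+3) - 2 * v (i+2) + v (i+1)\<bar> \<le> 2" using v[of "i+1"] v[of "i+2"] v[of "i+3"] by linarith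
      then have "(v (i+3) - 2 * v (i+2) + v (i+1))\<^sup>2 \<le> 2\<^sup>2" by (simp only: abs_le_square_iff[symmetric] abs_numeral)
      then have "g (i+1) * g (i+3) * (v (i+3) - 2 * v (i+2) + v (i+1))\<^sup>2 \<le> (real i + 2) ^ 3 * 4"
        using G by (intro mult_mono) auto
      also have "\<dots> = k i" using True by (simp add: k_def)
      finally show ?thesis using x one_x by (simp add: add_increasing2)
    next
      case False
      then have "v (i+3) - 2 * v (i+2) + v (i+1) = r * (1 - r)\<^sup>2 * r ^ i"
        by (simp add: v_def trial_profile_def power2_eq_square power3_eq_cube power_add algebra_simps)
      then have "(v (i+3) - 2 * v (i+2) + v (i+1))\<^sup>2 = x * ((1 - r) ^ 4 * x ^ i)"
        by (simp add: v_x_def(2) power_mult_distrib power_mult[symmetric] mult.commute)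
      also have "\<dots> \<le> 1 * ((1 - r) ^ 4 * x ^ i)" using x by (intro mult_right_mono) auto
      finally have "g (i+1) * g (i+3) * (v (i+3) - 2 * v (i+2) + v (i+1))\<^sup>2
          \<le> (real i + 2) ^ 3 * ((1 - r) ^ 4 * x ^ i)"
        using G by (intro mult_mono) auto
      \<comment> \<open>The cube is traded for a rising product, the form that
        \<open>sum_geometric_weighted_le\<close> sums.\<close>
      also have "\<dots> \<le> (2 * ((real i + 1) * (real i + 2) * (real i + 3))) * ((1 - r) ^ 4 * x ^ i)"
        using x by (intro mult_right_mono) (auto simp: power3_eq_cube algebra_simps)
      finally show ?thesis using False by (simp add: k_def mult_ac)
    qed
  qed
  have "remainder_sum v N \<le> (\<Sum>i<Suc N. h i + 6 * (1 - r)\<^sup>2 * ((real i + 1) * x ^ i))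
     + (\<Sum>i<N. k i + 2 * (1 - r) ^ 4 * ((real i + 1) * (real i + 2) * (real i + 3) * x ^ i))"
    unfolding remainder_sum_def lessThan_Suc_atMost by (intro add_mono sum_mono A B)
  also have "\<dots> = (\<Sum>i<Suc N. h i) + (\<Sum>i<N. k i) + 6 * ((1 - r)\<^sup>2 * (\<Sum>i<Suc N. (real i + 1) * x ^ i))
     + 2 * ((1 - r) ^ 4 * (\<Sum>i<N. (real i + 1) * (real i + 2) * (real i + 3) * x ^ i))"
    by (simp only: sum.distrib sum_distrib_left mult.assoc add_ac)
  also have "\<dots> \<le> (\<Sum>i<M. 3 * (real i + 2)) + (\<Sum>i<M. 4 * (real i + 2) ^ 3) + 6 * 1 + 2 * 6"
  proof (intro add_mono mult_left_mono)
    show "(\<Sum>i<Suc N. h i) \<le> (\<Sum>i<M. 3 * (real i + 2))" unfolding h_def by (rule cut) simp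
    show "(\<Sum>i<N. k i) \<le> (\<Sum>i<M. 4 * (real i + 2) ^ 3)" unfolding k_def by (rule cut) simp
    have "(1 - r)\<^sup>2 * (\<Sum>i<Suc N. (real i + 1) * x ^ i) \<le> (1 - x)\<^sup>2 * (1 / (1 - x)\<^sup>2)"
      using one_x sum_geometric_weighted_le(1)[OF x, of "Suc N"] x
      by (intro mult_mono power_mono sum_nonneg) auto
    then show "(1 - r)\<^sup>2 * (\<Sum>i<Suc N. (real i + 1) * x ^ i) \<le> 1" using one_x by simp
    have "(1 - r) ^ 4 * (\<Sum>i<N. (real i + 1) * (real i + 2) * (real i + 3) * x ^ i)
        \<le> (1 - x) ^ 4 * (6 / (1 - x) ^ 4)"
      using one_x sum_geometric_weighted_le(2)[OF x, of N] x
      by (intro mult_mono power_mono sum_nonneg) auto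
    then show "(1 - r) ^ 4 * (\<Sum>i<N. (real i + 1) * (real i + 2) * (real i + 3) * x ^ i) \<le> 6"
      using one_x by simp
  qed auto
  finally show ?thesis by (simp add: v_def sum.distrib)
qed

text \<open>Squeezed between 0, by \<open>boundary_term_nonneg\<close>, and a cubic polynomial times
  a decaying geometric sequence.\<close>

lemma boundary_term_trial_profile_tendsto_0:
  assumes "0 < r" "r < 1"
  shows "boundary_term (trial_profile M r) \<longlonglongrightarrow> 0"
proof -
  define x where "x = r\<^sup>2"
  have x: "0 \<le> x" "x < 1" using assms by (simp_all add: x_def abs_square_less_1)
  define f where "f n = 4 * ((real n + 1) * (real n + 2) * (real n + 3) * x ^ n)" for n
  have "f \<longlonglongrightarrow> 4 * 0"
    unfolding f_def by (intro tendsto_mult_left summable_LIMSEQ_zero summable_cubic_geometric x)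
  then have f: "f \<longlonglongrightarrow> 0" by simp
  have "boundary_term (trial_profile M r) n \<le> f n" if n: "max 1 M \<le> n" for n
  proof -
    have v: "trial_profile M r (n+1) = r * r ^ n" "trial_profile M r n = r ^ n" using n by (simp_all add: trial_profile_def)
    have rx: "(r ^ n)\<^sup>2 = x ^ n" by (simp add: x_def power_mult[symmetric] mult.commute)
    have a: "(r * r ^ n)\<^sup>2 \<le> x ^ n"
      using x by (simp add: power_mult_distrib rx mult_left_le_one_le flip: x_def)
    have "(r * r ^ n - r ^ n)\<^sup>2 = (1 - r)\<^sup>2 * x ^ n"
      unfolding rx[symmetric] by (simp add: power2_eq_square algebra_simps)
    also have "\<dots> \<le> x ^ n" using x assms by (simp add: mult_left_le_one_le abs_square_le_1)
    finally have b: "(r * r ^ n - r ^ n)\<^sup>2 \<le> x ^ n" .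
    have "g_diff2 n \<le> 2 * g (n+1)" 
      unfolding g_diff2_def using g_mono[OF order_trans[OF diff_le_self le_add1], of n 1 1] g_nonneg[of n]
      by (simp del: g_nonneg)
    then have "g_diff2 n * g (n+1) \<le> 2 * (g (n+1))\<^sup>2" 
      using mult_right_mono[of "g_diff2 n" "2 * g (n+1)" "g (n+1)"] by (simp add: power2_eq_square)
    also have "\<dots> = 2 * (real n + 1) ^ 3" by (simp add: g_square add.commute)
    finally have c: "g_diff2 n * g (n+1) \<le> 2 * (real n + 1) ^ 3" .
    have "2 * g n * (g (n+2) - g (n+1)) \<le> 2 * (g n * g (n+2))" by (simp add: algebra_simps)
    also have "\<dots> \<le> 2 * (real n + 1) ^ 3" using g_prod_le by simp
    finally have d: "2 * g n * (g (n+2) - g (n+1)) \<le> 2 * (real n + 1) ^ 3" .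
    have "boundary_term (trial_profile M r) n \<le> g_diff2 n * g (n+1) * (r * r ^ n)\<^sup>2
        + 2 * g n * (g (n+2) - g (n+1)) * (r * r ^ n - r ^ n)\<^sup>2"
      using g_diff2_nonneg[of "n+1"] unfolding boundary_term_def v by simp
    also have "\<dots> \<le> 2 * (real n + 1) ^ 3 * x ^ n + 2 * (real n + 1) ^ 3 * x ^ n"
      by (intro add_mono mult_mono[OF c a] mult_mono[OF d b]) auto
    also have "\<dots> = 4 * ((real n + 1) ^ 3 * x ^ n)" by simp
    also have "\<dots> \<le> f n"
      unfolding f_def using x
      by (intro mult_left_mono mult_right_mono) (auto simp: power3_eq_cube algebra_simps)
    finally show ?thesis .
  qed
  then have "\<forall>\<^sub>F n in sequentially. boundary_term (trial_profile M r) n \<le> f n"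
    unfolding eventually_sequentially by blast
  moreover have "\<forall>\<^sub>F n in sequentially. 0 \<le> boundary_term (trial_profile M r) n"
    unfolding eventually_sequentially using boundary_term_nonneg by (auto intro!: exI[of _ 1])
  ultimately show ?thesis by (intro tendsto_sandwich[OF _ _ tendsto_const f])
qed

definition trial_fun :: "nat \<Rightarrow> real \<Rightarrow> nat \<Rightarrow> complex" where
  "trial_fun M r n = of_real (g n * trial_profile M r n)"

lemma trial_fun_in_H0:
  assumes "0 < r" "r < 1"
  shows "trial_fun M r \<in> H0 M"
proof -
  have "summable (\<lambda>n. (cmod (trial_fun M r n))\<^sup>2)"
  proof (rule summable_comparison_test')
    show "summable (\<lambda>n. (real n + 1) * (real n + 2) * (real n + 3) * (r\<^sup>2) ^ n)"
      using assms by (intro summable_cubic_geometric) (simp_all add: abs_square_less_1)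
    fix n :: nat
    have "(cmod (trial_fun M r n))\<^sup>2 = real n ^ 3 * (trial_profile M r n)\<^sup>2"
      by (simp add: trial_fun_def norm_mult power_mult_distrib g_square)
    also have "\<dots> \<le> real n ^ 3 * (r\<^sup>2) ^ n"
      by (intro mult_left_mono) (auto simp: trial_profile_def power_mult[symmetric] mult.commute[of n] zero_le_even_power)
    also have "\<dots> \<le> (real n + 1) * (real n + 2) * (real n + 3) * (r\<^sup>2) ^ n"
      by (intro mult_right_mono) (auto simp: power3_eq_cube algebra_simps)
    finally show "norm ((cmod (trial_fun M r n))\<^sup>2) \<le> (real n + 1) * (real n + 2) * (real n + 3) * (r\<^sup>2) ^ n"
      by simp
  qed
  then show ?thesis by (auto simp: H0_def trial_fun_def trial_profile_def)
qed

lemma trial_fun_nonzero: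
  assumes "0 < r"
  shows "trial_fun M r \<noteq> (\<lambda>n. 0)"
proof
  assume "trial_fun M r = (\<lambda>n. 0)"
  then have "trial_fun M r (Suc M) = 0" by simp
  then show False using assms g_pos[of "Suc M"] by (simp add: trial_fun_def trial_profile_def)
qed

text \<open>The limit of \<open>rellich_identity\<close>: the remainder is bounded uniformly in
  \<open>N\<close> and the boundary term tends to 0.\<close>

lemma lhs_trial_fun_le:
  assumes "0 < r" "r < 1" "2 \<le> M"
  shows "lhs (trial_fun M r) \<le> rhs (trial_fun M r) + ((\<Sum>i<M. 3 * (real i + 2) + 4 * (real i + 2) ^ 3) + 18)"
    (is "_ \<le> _ + ?C")
proof -
  let ?u = "trial_fun M r" and ?v = "trial_profile M r"
  note P = H0_props[OF trial_fun_in_H0[OF assms(1,2)] assms(3)]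
  have v1: "?v 1 = 0" using assms by (simp add: trial_profile_def)
  have L: "(cmod (neg_lap ?u (Suc i)))\<^sup>2 = (second_diff (\<lambda>n. g n * ?v n) i)\<^sup>2" for i
    unfolding neg_lap_Suc_norm by (simp add: trial_fun_def second_diff_def)
  have R: "(cmod (?u n))\<^sup>2 = (g n * ?v n)\<^sup>2" for n
    by (simp add: trial_fun_def norm_mult power_mult_distrib)
  have nn: "0 \<le> rho2 (i+2) * (cmod (?u (i+2)))\<^sup>2" for i using rho2_pos[of "i+2"] by simp
  have "(\<Sum>i<N. rho2 (i+2) * (cmod (?u (i+2)))\<^sup>2) \<le> rhs ?u" for N
    unfolding rhs_def by (intro sum_le_suminf rellich_strong(1) P) (use nn in auto)
  then have bound: "(\<Sum>i<Suc N. (cmod (neg_lap ?u (Suc i)))\<^sup>2) \<le> rhs ?u + ?C + boundary_term ?v (Suc N)" for N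
    using rellich_identity[of ?v N, OF v1] remainder_sum_trial_profile_le[OF assms(1,2), of M N]
    unfolding lessThan_Suc_atMost by (simp add: L R add_mono)
  have "(\<lambda>N. \<Sum>i<Suc N. (cmod (neg_lap ?u (Suc i)))\<^sup>2) \<longlonglongrightarrow> lhs ?u"
    unfolding lhs_def using LIMSEQ_Suc[OF summable_LIMSEQ[OF P(3)]] .
  moreover have "(\<lambda>N. rhs ?u + ?C + boundary_term ?v (Suc N)) \<longlonglongrightarrow> rhs ?u + ?C + 0"
    by (intro tendsto_add tendsto_const LIMSEQ_Suc boundary_term_trial_profile_tendsto_0 assms)
  ultimately have "lhs ?u \<le> rhs ?u + ?C + 0"
    by (rule LIMSEQ_le) (use bound in blast)
  then show ?thesis by simp
qed

text \<open>For M < n \<le> K the n-th term is at least r^(2n) / (4n), hence at least 1/(8n) once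
  r^(2K) > 1/2; the harmonic series then exceeds any bound.\<close>

lemma rhs_trial_fun_unbounded:
  assumes "2 \<le> M"
  shows "\<exists>r>0. r < 1 \<and> L \<le> rhs (trial_fun M r)"
proof -
  have "\<forall>\<^sub>F n in sequentially. 8 * L + harm M \<le> (harm n :: real)"
    using harm_at_top by (simp add: filterlim_at_top)
  then obtain K0 where K0: "\<And>n. K0 \<le> n \<Longrightarrow> 8 * L + harm M \<le> (harm n :: real)"
    by (auto simp: eventually_sequentially)
  define K where "K = K0 + M"
  \<comment> \<open>\<open>K\<close> is fixed before \<open>r\<close>, so \<open>r\<close> can be
    taken close enough to 1 for all the chosen terms at once.\<close>
  have "((\<lambda>r::real. r ^ (2 * K)) \<longlongrightarrow> 1 ^ (2 * K)) (at_left 1)"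
    by (intro tendsto_intros)
  then have "\<forall>\<^sub>F r in at_left 1. (1/2 :: real) < r ^ (2 * K)"
    by (rule order_tendstoD) simp
  moreover have "\<forall>\<^sub>F r::real in at_left 1. r \<in> {0<..<1}"
    by (rule eventually_at_leftI[of 0]) auto
  ultimately have "\<forall>\<^sub>F r::real in at_left 1. 1/2 < r ^ (2 * K) \<and> r \<in> {0<..<1}"
    by (rule eventually_conj)
  then obtain r :: real where r: "1/2 < r ^ (2 * K)" "0 < r" "r < 1"
    using eventually_happens'[of "at_left (1::real)"] by (auto simp: trivial_limit_at_left_real)
  let ?u = "trial_fun M r"
  note P = H0_props[OF trial_fun_in_H0[OF r(2,3)] assms]
  have nn: "0 \<le> rho2 (i+2) * (cmod (?u (i+2)))\<^sup>2" for i using rho2_pos[of "i+2"] by simp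
  have term_ge: "1 / (8 * real n) \<le> rho2 n * (cmod (?u n))\<^sup>2" if n: "M < n" "n \<le> K" for n
  proof -
    have u: "(cmod (?u n))\<^sup>2 = real n ^ 3 * r ^ (2 * n)"
      using n by (simp add: trial_fun_def trial_profile_def norm_mult norm_power power_mult_distrib
          g_square power_mult mult.commute[of 2] flip: of_real_power)
    have "r ^ (2 * K) \<le> r ^ (2 * n)" using n r by (intro power_decreasing) auto
    then have "1/2 \<le> r ^ (2 * n)" using r by linarith
    have "1 / (8 * real n) = 1 / (4 * real n ^ 4) * (real n ^ 3 * (1/2))"
      using n by (simp add: power4_eq_xxxx power3_eq_cube)
    also have "\<dots> \<le> rho2 n * (real n ^ 3 * r ^ (2 * n))"
      using rho2_ge[of n] \<open>1/2 \<le> r ^ (2 * n)\<close> n assms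
      by (intro mult_mono mult_left_mono) (auto simp: rho2_pos less_imp_le)
    finally show ?thesis by (simp add: u)
  qed
  have harm_split: "harm K = harm M + (\<Sum>n\<in>{M<..K}. 1 / real n)"
  proof -
    have "{1..K} = {1..M} \<union> {M<..K}" by (auto simp: K_def)
    then show ?thesis unfolding harm_def
      by (simp add: sum.union_disjoint divide_inverse disjoint_iff)
  qed
  have "8 * L \<le> (\<Sum>n\<in>{M<..K}. 1 / real n)" using K0[of K] harm_split by (simp add: K_def)
  then have "L \<le> (\<Sum>n\<in>{M<..K}. 1 / (8 * real n))"
    by (simp add: sum_divide_distrib[symmetric] mult.commute[of 8] flip: divide_divide_eq_left)
  also have "\<dots> \<le> (\<Sum>n\<in>{M<..K}. rho2 n * (cmod (?u n))\<^sup>2)" by (intro sum_mono term_ge) auto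
  \<comment> \<open>The truncated subtraction is injective here since n > M \<ge> 2.\<close>
  also have "\<dots> = (\<Sum>i\<in>(\<lambda>n. n - 2) ` {M<..K}. rho2 (i+2) * (cmod (?u (i+2)))\<^sup>2)"
    using assms by (subst sum.reindex) (auto simp: inj_on_def simp del: add_2_eq_Suc' intro!: sum.cong)
  also have "\<dots> \<le> rhs ?u"
    unfolding rhs_def by (intro sum_le_suminf rellich_strong(1) P) (use nn in auto)
  finally show ?thesis using r by blast
qed

text \<open>\<open>rellich_ge\<close> bounds every quotient below by 1; for the trial functions
  numerator and denominator differ by at most a constant while the denominator is unbounded.\<close>

lemma Inf_quotient:
  assumes "2 \<le> M"
  shows "Inf {lhs u / rhs u | u. u \<in> H0 M \<and> u \<noteq> (\<lambda>n. 0)} = 1" (is "Inf ?S = 1")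
proof -
  have ge: "1 \<le> y" if "y \<in> ?S" for y
    using that rellich_ge rhs_pos assms by (auto simp: le_divide_eq)
  have lt: "\<exists>y\<in>?S. y < 1 + e" if e: "0 < e" for e
  proof -
    define C where "C = (\<Sum>i<M. 3 * (real i + 2) + 4 * (real i + 2) ^ 3) + 18"
    have C: "0 < C" unfolding C_def by (intro add_nonneg_pos sum_nonneg) auto
    \<comment> \<open>The factor 2 leaves room for the strict inequality: C < 2 C \<le> e
      \<open>rhs (trial_fun M r)\<close>.\<close>
    obtain r where r: "0 < r" "r < 1" "2 * C / e \<le> rhs (trial_fun M r)"
      using rhs_trial_fun_unbounded[OF assms] by blast
    have pos: "0 < rhs (trial_fun M r)" using less_le_trans[OF _ r(3)] C e by simp
    have "2 * C \<le> e * rhs (trial_fun M r)" using r(3) e by (simp add: field_simps)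
    then have "lhs (trial_fun M r) < (1 + e) * rhs (trial_fun M r)"
      using lhs_trial_fun_le[OF r(1,2) assms] C unfolding C_def[symmetric] by (simp add: algebra_simps)
    then have "lhs (trial_fun M r) / rhs (trial_fun M r) < 1 + e" using pos by (simp add: divide_less_eq)
    then show ?thesis using trial_fun_in_H0[OF r(1,2), of M] trial_fun_nonzero[OF r(1), of M] by blast
  qed
  show ?thesis
  proof (rule cInf_eq)
    show "y \<le> 1" if "\<And>x. x \<in> ?S \<Longrightarrow> y \<le> x" for y
    proof (rule field_le_epsilon)
      fix e :: real assume "0 < e"
      then show "y \<le> 1 + e" using lt that by (meson less_imp_le order_trans)
    qed
  qed (use ge in auto)
qed

theorem theorem1p1:
  shows "(\<forall>u \<in> H0 2. lhs u \<ge> rhs u)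
    \<and> (\<forall>u :: nat \<Rightarrow> complex. u 0 = 0 \<and> u 1 = 0
          \<and> summable (\<lambda>n. rho2 (n+2) * (cmod (u (n+2)))^2)
          \<and> summable (\<lambda>n. (cmod (neg_lap u (Suc n)))^2)
          \<and> lhs u = rhs u \<longrightarrow> u = (\<lambda>n. 0))
    \<and> (\<forall>M::nat. M \<ge> 2 \<longrightarrow>
          Inf {lhs u / rhs u | u. u \<in> H0 M \<and> u \<noteq> (\<lambda>n. 0)} = 1)"
  using rellich_ge[of _ 2] equality_imp_zero Inf_quotient by blast

end
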